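(* Let $G_1$ and $G_2$ be infinite simple graphs on countably many vertices, each labeled by $\mathbb{N}$, and let $\Lambda\subset\mathbb{R}$ be compact and infinite. Let $S$ and $T$ be any constructed solutions (as defined in the context) of the SISP with data $(G_1,\Lambda)$ and $(G_2,\Lambda)$, respectively. Then $S$ and $T$ are approximately unitarily equivalent. In particular, $T\sim_a\operatorname{diag}(\lambda_1,\lambda_2,\dots)$ for any countable dense subset $\{\lambda_1,\lambda_2,\dots\}$ of $\Lambda$ (enumerated without repetition).
   Context: All matrices are real. For a symmetric matrix $A$ (finite, or infinite and indexed by $\mathbb{N}$), a simple graph $G$ is the graph of $A$ when for all $i\ne j$, $A_{ij}\neq 0$ if and only if $i$ and $j$ are adjacent in $G$. $G[S]$ is the subgraph of $G$ induced on $S$. A finite symmetric matrix $A$ has the Weak Spectral Property (WSP) if $X=O$ is the only symmetric matrix $X$ of the same size with $X\circ I=O$ (entrywise product, i.e. $X$ has zero diagonal) and $XA-AX=O$. Constructed solution of the SISP (structured inverse spectrum problem) with data $(G,\Lambda)$: choose a countable dense subset $\{\lambda_1,\lambda_2,\dots\}$ of $\Lambda$, enumerated without repetition. Choose $n\times n$ real symmetric matrices $\widetilde A_n$, $n\ge 1$, with $\widetilde A_1=[\lambda_1]$, such that for every $n$: the graph of $\widetilde A_n$ is $G[\{1,\dots,n\}]$; the spectrum of $\widetilde A_n$ is $\{\lambda_1,\dots,\lambda_n\}$; $\widetilde A_n$ has the WSP; $\widetilde A_{n+1}$ is obtained from $\widetilde A_n\oplus[\lambda_{n+1}]$ by changing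 only diagonal entries and the off-diagonal entries in the last row and last column; and $\|\widetilde A_n\oplus[\lambda_{n+1}]-\widetilde A_{n+1}\|_{\mathrm{op}}<2^{-n}$, where $\|\cdot\|_{\mathrm{op}}$ is the operator norm. Let $T_n$ be the bounded operator on $\ell^2(\mathbb{N})$ whose matrix in the standard basis is $\widetilde A_n\oplus\operatorname{diag}(\lambda_{n+1},\lambda_{n+2},\dots)$. The sequence $(T_n)$ converges in operator norm, and $T=\lim_{n\to\infty}T_n$ is called a constructed solution of the SISP with data $(G,\Lambda)$ (relative to $\{\lambda_1,\lambda_2,\dots\}$). The dense subsets (and enumerations) used for two constructed solutions may be different. Two bounded operators $T_1,T_2$ on Hilbert spaces $\mathcal{H}_1,\mathcal{H}_2$ are approximately unitarily equivalent, written $T_1\sim_a T_2$, if there is a sequence of unitary isomorphisms $U_n\colon\mathcal{H}_1\to\mathcal{H}_2$ such that $T_1=\lim_{n\to\infty}U_n^*T_2U_n$ in operator norm. $\operatorname{diag}(\lambda_1,\lambda_2,\dots)$ denotes the diagonal operator on $\ell^2(\mathbb{N})$ with these diagonal entries. *)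

theory Defs
  imports "HOL-Analysis.Bounded_Linear_Function" "Jordan_Normal_Form.Spectral_Radius"
begin

subsection \<open>The Hilbert space of square-summable sequences\<close>

text \<open>
  All matrices below are real, but they may act on real or on complex sequences, so the scalars
  are kept generic. Up to isomorphism the reals and the complex numbers are the only instances of
  the following class.
\<close>

class hilbert_scalar = real_normed_field + real_inner + complete_space

instance real :: hilbert_scalar ..
instance complex :: hilbert_scalar ..

typedef (overloaded) 'k ell2 =
  "{x :: nat \<Rightarrow> 'k::hilbert_scalar. summable (\<lambda>i. (norm (x i))\<^sup>2)}"
  morphisms coord Abs_ell2
  by (rule exI[of _ "\<lambda>_. 0"]) simp

setup_lifting type_definition_ell2

lemma ell2_eqI: "(\<And>i. coord x i = coord y i) \<Longrightarrow> x = y"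
  by (simp add: coord_inject[symmetric] fun_eq_iff)

lemma summable_coord: "summable (\<lambda>i. (norm (coord x i))\<^sup>2)"
  using coord[of x] by simp

lemma square_summable_add:
  fixes x y :: "nat \<Rightarrow> 'a::real_normed_vector"
  assumes "summable (\<lambda>i. (norm (x i))\<^sup>2)" "summable (\<lambda>i. (norm (y i))\<^sup>2)"
  shows "summable (\<lambda>i. (norm (x i + y i))\<^sup>2)"
proof (rule summable_comparison_test')
  show "summable (\<lambda>i. 2 * (norm (x i))\<^sup>2 + 2 * (norm (y i))\<^sup>2)"
    by (intro summable_add summable_mult assms)
  show "norm ((norm (x i + y i))\<^sup>2) \<le> 2 * (norm (x i))\<^sup>2 + 2 * (norm (y i))\<^sup>2" if "i \<ge> 0" for i
  proof -
    have "(norm (x i + y i))\<^sup>2 \<le> (norm (x i) + norm (y i))\<^sup>2"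
      by (intro power_mono norm_triangle_ineq) auto
    also have "\<dots> \<le> 2 * (norm (x i))\<^sup>2 + 2 * (norm (y i))\<^sup>2"
      using zero_le_power2[of "norm (x i) - norm (y i)"]
      by (simp add: power2_eq_square algebra_simps)
    finally show ?thesis by simp
  qed
qed

lemma square_summable_inner:
  fixes x y :: "nat \<Rightarrow> 'a::real_inner"
  assumes "summable (\<lambda>i. (norm (x i))\<^sup>2)" "summable (\<lambda>i. (norm (y i))\<^sup>2)"
  shows "summable (\<lambda>i. inner (x i) (y i))"
proof (rule summable_comparison_test')
  show "summable (\<lambda>i. (norm (x i))\<^sup>2 + (norm (y i))\<^sup>2)"
    by (intro summable_add assms)
  show "norm (inner (x i) (y i)) \<le> (norm (x i))\<^sup>2 + (norm (y i))\<^sup>2" if "i \<ge> 0" for i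
  proof -
    have "norm (inner (x i) (y i)) \<le> norm (x i) * norm (y i)"
      using Cauchy_Schwarz_ineq2 by simp
    also have "\<dots> \<le> (norm (x i))\<^sup>2 + (norm (y i))\<^sup>2"
      using sum_squares_bound[of "norm (x i)" "norm (y i)"]
        mult_nonneg_nonneg[OF norm_ge_zero[of "x i"] norm_ge_zero[of "y i"]]
      by linarith
    finally show ?thesis .
  qed
qed

instantiation ell2 :: (hilbert_scalar) real_inner
begin

lift_definition zero_ell2 :: "'a ell2" is "\<lambda>_. 0" by simp
lift_definition plus_ell2 :: "'a ell2 \<Rightarrow> 'a ell2 \<Rightarrow> 'a ell2" is "\<lambda>x y i. x i + y i"
  by (rule square_summable_add)
lift_definition uminus_ell2 :: "'a ell2 \<Rightarrow> 'a ell2" is "\<lambda>x i. - x i" by simp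
lift_definition minus_ell2 :: "'a ell2 \<Rightarrow> 'a ell2 \<Rightarrow> 'a ell2" is "\<lambda>x y i. x i - y i"
proof -
  fix x y :: "nat \<Rightarrow> 'a"
  assume "summable (\<lambda>i. (norm (x i))\<^sup>2)" "summable (\<lambda>i. (norm (y i))\<^sup>2)"
  then show "summable (\<lambda>i. (norm (x i - y i))\<^sup>2)"
    using square_summable_add[of x "\<lambda>i. - y i"] by simp
qed
lift_definition scaleR_ell2 :: "real \<Rightarrow> 'a ell2 \<Rightarrow> 'a ell2" is "\<lambda>r x i. r *\<^sub>R x i"
  by (simp add: power_mult_distrib summable_mult)

text \<open>For complex scalars this is the real part of the usual inner product; it induces the same
  norm, and the same adjoints of complex-linear operators.\<close>

lift_definition inner_ell2 :: "'a ell2 \<Rightarrow> 'a ell2 \<Rightarrow> real" is "\<lambda>x y. \<Sum>i. inner (x i) (y i)" .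

definition norm_ell2 :: "'a ell2 \<Rightarrow> real" where "norm_ell2 x = sqrt (inner x x)"
definition dist_ell2 :: "'a ell2 \<Rightarrow> 'a ell2 \<Rightarrow> real" where "dist_ell2 x y = norm (x - y)"
definition sgn_ell2 :: "'a ell2 \<Rightarrow> 'a ell2" where "sgn_ell2 x = inverse (norm x) *\<^sub>R x"
definition uniformity_ell2 :: "('a ell2 \<times> 'a ell2) filter" where
  "uniformity_ell2 = (INF e\<in>{0<..}. principal {(x, y). dist x y < e})"
definition open_ell2 :: "'a ell2 set \<Rightarrow> bool" where
  "open_ell2 U \<longleftrightarrow> (\<forall>x\<in>U. eventually (\<lambda>(x', y). x' = x \<longrightarrow> y \<in> U) uniformity)"

instance
proof
  fix x y z :: "'a ell2" and a b :: real
  show "x + y + z = x + (y + z)" by transfer (simp add: add.assoc)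
  show "x + y = y + x" by transfer (simp add: add.commute)
  show "0 + x = x" by transfer simp
  show "- x + x = 0" by transfer simp
  show "x - y = x + - y" by transfer simp
  show "a *\<^sub>R (x + y) = a *\<^sub>R x + a *\<^sub>R y" by transfer (simp add: scaleR_add_right)
  show "(a + b) *\<^sub>R x = a *\<^sub>R x + b *\<^sub>R x" by transfer (simp add: scaleR_add_left)
  show "a *\<^sub>R b *\<^sub>R x = (a * b) *\<^sub>R x" by transfer simp
  show "1 *\<^sub>R x = x" by transfer simp
  show "sgn x = inverse (norm x) *\<^sub>R x" by (rule sgn_ell2_def)
  show "dist x y = norm (x - y)" by (rule dist_ell2_def)
  show "(uniformity :: ('a ell2 \<times> 'a ell2) filter) =
      (INF e\<in>{0<..}. principal {(x, y). dist x y < e})" by (rule uniformity_ell2_def)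
  show "open U \<longleftrightarrow> (\<forall>x\<in>U. eventually (\<lambda>(x', y). x' = x \<longrightarrow> y \<in> U) uniformity)"
    for U :: "'a ell2 set" by (rule open_ell2_def)
  show "inner x y = inner y x" by transfer (simp add: inner_commute)
  show "inner (x + y) z = inner x z + inner y z"
    by transfer (simp add: inner_add_left suminf_add square_summable_inner)
  show "inner (a *\<^sub>R x) y = a * inner x y"
    by transfer (simp add: suminf_mult square_summable_inner)
  show "0 \<le> inner x x"
    by transfer (simp add: suminf_nonneg square_summable_inner)
  show "inner x x = 0 \<longleftrightarrow> x = 0"
    by transfer (subst suminf_eq_zero_iff, auto simp: square_summable_inner fun_eq_iff)
  show "norm x = sqrt (inner x x)" by (rule norm_ell2_def)
qed

end

lemma coord_add [simp]: "coord (x + y) i = coord x i + coord y i"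
  by transfer simp

lemma coord_diff [simp]: "coord (x - y) i = coord x i - coord y i"
  by transfer simp

lemma coord_scaleR [simp]: "coord (r *\<^sub>R x) i = r *\<^sub>R coord x i"
  by transfer simp

lemma coord_zero [simp]: "coord 0 i = 0"
  by transfer simp

lemma norm_ell2_sq: "(norm x)\<^sup>2 = (\<Sum>i. (norm (coord x i))\<^sup>2)"
  by (simp add: power2_norm_eq_inner inner_ell2.rep_eq)

lemma norm_coord_le: "norm (coord x i) \<le> norm x"
proof (rule power2_le_imp_le)
  show "(norm (coord x i))\<^sup>2 \<le> (norm x)\<^sup>2"
    unfolding norm_ell2_sq using sum_le_suminf[OF summable_coord, of "{i}" x] by simp
qed simp

instance ell2 :: (hilbert_scalar) complete_space
proof
  fix X :: "nat \<Rightarrow> 'a ell2"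
  assume X: "Cauchy X"
  have "Cauchy (\<lambda>n. coord (X n) i)" for i
  proof (rule metric_CauchyI)
    fix e :: real assume "e > 0"
    then obtain N where N: "\<And>m n. m \<ge> N \<Longrightarrow> n \<ge> N \<Longrightarrow> dist (X m) (X n) < e"
      using metric_CauchyD[OF X] by blast
    show "\<exists>M. \<forall>m\<ge>M. \<forall>n\<ge>M. dist (coord (X m) i) (coord (X n) i) < e"
    proof (intro exI allI impI)
      fix m n assume "m \<ge> N" "n \<ge> N"
      then show "dist (coord (X m) i) (coord (X n) i) < e"
        using N[of m n] norm_coord_le[of "X m - X n" i] by (simp add: dist_norm)
    qed
  qed
  then have "\<forall>i. \<exists>l. (\<lambda>n. coord (X n) i) \<longlonglongrightarrow> l"
    by (simp add: Cauchy_convergent convergent_def[symmetric])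
  then obtain L where L: "\<And>i. (\<lambda>n. coord (X n) i) \<longlonglongrightarrow> L i"
    unfolding choice_iff by blast
  have tail: "\<exists>N. \<forall>n\<ge>N. \<forall>k. (\<Sum>i<k. (norm (coord (X n) i - L i))\<^sup>2) \<le> e\<^sup>2" if "e > 0" for e
  proof -
    obtain N where N: "\<And>m n. m \<ge> N \<Longrightarrow> n \<ge> N \<Longrightarrow> dist (X m) (X n) < e"
      using metric_CauchyD[OF X \<open>e > 0\<close>] by blast
    have "(\<Sum>i<k. (norm (coord (X n) i - L i))\<^sup>2) \<le> e\<^sup>2" if "n \<ge> N" for n k
    proof (rule LIMSEQ_le_const2)
      show "(\<lambda>m. \<Sum>i<k. (norm (coord (X n) i - coord (X m) i))\<^sup>2)
          \<longlonglongrightarrow> (\<Sum>i<k. (norm (coord (X n) i - L i))\<^sup>2)"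
        by (intro tendsto_intros L)
      show "\<exists>N. \<forall>m\<ge>N. (\<Sum>i<k. (norm (coord (X n) i - coord (X m) i))\<^sup>2) \<le> e\<^sup>2"
      proof (intro exI allI impI)
        fix m assume "m \<ge> N"
        have "(\<Sum>i<k. (norm (coord (X n) i - coord (X m) i))\<^sup>2) \<le> (norm (X n - X m))\<^sup>2"
          unfolding norm_ell2_sq
          using sum_le_suminf[OF summable_coord, of "{..<k}" "X n - X m"] by simp
        also have "\<dots> \<le> e\<^sup>2"
          using N[OF \<open>n \<ge> N\<close> \<open>m \<ge> N\<close>] by (intro power_mono) (auto simp: dist_norm)
        finally show "(\<Sum>i<k. (norm (coord (X n) i - coord (X m) i))\<^sup>2) \<le> e\<^sup>2" .
      qed
    qed
    then show ?thesis by blast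
  qed
  obtain N where N: "\<And>k. (\<Sum>i<k. (norm (coord (X N) i - L i))\<^sup>2) \<le> 1"
    using tail[of 1] by auto
  have "summable (\<lambda>i. (norm (L i - coord (X N) i))\<^sup>2)"
    by (rule summableI_nonneg_bounded[where x = 1]) (use N in \<open>auto simp: norm_minus_commute\<close>)
  from square_summable_add[OF this summable_coord[of "X N"]]
  have L': "summable (\<lambda>i. (norm (L i))\<^sup>2)" by simp
  define l where "l = Abs_ell2 L"
  have l: "coord l = L" unfolding l_def by (subst Abs_ell2_inverse) (use L' in auto)
  have "X \<longlonglongrightarrow> l"
  proof (rule metric_LIMSEQ_I)
    fix r :: real assume r: "r > 0"
    obtain N where N: "\<And>n k. n \<ge> N \<Longrightarrow> (\<Sum>i<k. (norm (coord (X n) i - L i))\<^sup>2) \<le> (r/2)\<^sup>2"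
      using tail[of "r/2"] r by auto
    have "dist (X n) l < r" if "n \<ge> N" for n
    proof -
      have "(norm (X n - l))\<^sup>2 \<le> (r/2)\<^sup>2"
        unfolding norm_ell2_sq
        by (rule suminf_le_const[OF summable_coord]) (use N[OF that] l in auto)
      then have "norm (X n - l) \<le> r/2"
        by (rule power2_le_imp_le) (use r in simp)
      with r show ?thesis by (simp add: dist_norm)
    qed
    then show "\<exists>no. \<forall>n\<ge>no. dist (X n) l < r" by blast
  qed
  then show "convergent X" by (rule convergentI)
qed

lift_definition scale_ell2 :: "'k::hilbert_scalar \<Rightarrow> 'k ell2 \<Rightarrow> 'k ell2" is "\<lambda>c x i. c * x i"
  by (simp add: norm_mult power_mult_distrib summable_mult)

lift_definition unit_ell2 :: "nat \<Rightarrow> 'k::hilbert_scalar ell2" is "\<lambda>j i. if i = j then 1 else 0"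
  by (rule summable_finite[where N = "{j}" for j]) auto


subsection \<open>Operators\<close>

text \<open>
  Elements of \<^typ>\<open>'k ell2 \<Rightarrow>\<^sub>L 'k ell2\<close> are bounded and real-linear, and their norm is the
  operator norm; linearity over the scalars has to be added.
\<close>

definition scalar_linear :: "('k::hilbert_scalar ell2 \<Rightarrow>\<^sub>L 'k ell2) \<Rightarrow> bool" where
  "scalar_linear T \<longleftrightarrow>
     (\<forall>c x. blinfun_apply T (scale_ell2 c x) = scale_ell2 c (blinfun_apply T x))"

definition is_adjoint ::
    "('k::hilbert_scalar ell2 \<Rightarrow>\<^sub>L 'k ell2) \<Rightarrow> ('k ell2 \<Rightarrow>\<^sub>L 'k ell2) \<Rightarrow> bool" where
  "is_adjoint V U \<longleftrightarrow> (\<forall>x y. inner (blinfun_apply U x) y = inner x (blinfun_apply V y))"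

definition unitary_with_adjoint ::
    "('k::hilbert_scalar ell2 \<Rightarrow>\<^sub>L 'k ell2) \<Rightarrow> ('k ell2 \<Rightarrow>\<^sub>L 'k ell2) \<Rightarrow> bool" where
  "unitary_with_adjoint U V \<longleftrightarrow>
     scalar_linear U \<and> is_adjoint V U \<and> V o\<^sub>L U = id_blinfun \<and> U o\<^sub>L V = id_blinfun"

definition approx_unitarily_equiv ::
    "('k::hilbert_scalar ell2 \<Rightarrow>\<^sub>L 'k ell2) \<Rightarrow> ('k ell2 \<Rightarrow>\<^sub>L 'k ell2) \<Rightarrow> bool"
    (infix \<open>\<sim>\<^sub>a\<close> 50) where
  "T1 \<sim>\<^sub>a T2 \<longleftrightarrow>
     (\<exists>U V. (\<forall>n. unitary_with_adjoint (U n) (V n)) \<and> (\<lambda>n. V n o\<^sub>L T2 o\<^sub>L U n) \<longlonglongrightarrow> T1)"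

definition has_matrix :: "('k::hilbert_scalar ell2 \<Rightarrow>\<^sub>L 'k ell2) \<Rightarrow> (nat \<Rightarrow> nat \<Rightarrow> real) \<Rightarrow> bool" where
  "has_matrix T M \<longleftrightarrow> scalar_linear T \<and>
     (\<forall>i j. coord (blinfun_apply T (unit_ell2 j)) i = of_real (M i j))"

lemma square_summable_diag:
  fixes x :: "nat \<Rightarrow> 'k::real_normed_field"
  assumes C: "\<And>i. \<bar>lam i\<bar> \<le> C" and x: "summable (\<lambda>i. (norm (x i))\<^sup>2)"
  shows "summable (\<lambda>i. (norm (of_real (lam i) * x i))\<^sup>2)"
    and "(\<Sum>i. (norm (of_real (lam i) * x i))\<^sup>2) \<le> C\<^sup>2 * (\<Sum>i. (norm (x i))\<^sup>2)"
proof -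
  have le: "(norm (of_real (lam i) * x i))\<^sup>2 \<le> C\<^sup>2 * (norm (x i))\<^sup>2" for i
  proof -
    have "(lam i)\<^sup>2 \<le> C\<^sup>2"
      using power_mono[OF C[of i], of 2] by simp
    then have "(lam i)\<^sup>2 * (norm (x i))\<^sup>2 \<le> C\<^sup>2 * (norm (x i))\<^sup>2"
      by (rule mult_right_mono) simp
    then show ?thesis by (simp add: norm_mult power_mult_distrib)
  qed
  have C2: "summable (\<lambda>i. C\<^sup>2 * (norm (x i))\<^sup>2)"
    by (rule summable_mult[OF x])
  show *: "summable (\<lambda>i. (norm (of_real (lam i) * x i))\<^sup>2)"
    by (rule summable_comparison_test'[OF C2, of 0]) (use le in simp)
  show "(\<Sum>i. (norm (of_real (lam i) * x i))\<^sup>2) \<le> C\<^sup>2 * (\<Sum>i. (norm (x i))\<^sup>2)"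
    using suminf_le[OF le * C2] by (simp only: suminf_mult[OF x])
qed

lemma bounded_range_real:
  assumes "bounded (range (lam :: nat \<Rightarrow> real))"
  obtains C where "C \<ge> 0" "\<And>i. \<bar>lam i\<bar> \<le> C"
proof -
  obtain C where "\<And>i. \<bar>lam i\<bar> \<le> C"
    using assms unfolding bounded_iff by auto
  moreover from this[of 0] have "C \<ge> 0" by linarith
  ultimately show ?thesis using that by blast
qed

text \<open>The unbounded case is a dummy: boundedness of the diagonal entries is exactly what makes
  the diagonal operator bounded.\<close>

lift_definition diag_ell2 :: "(nat \<Rightarrow> real) \<Rightarrow> 'k::hilbert_scalar ell2 \<Rightarrow> 'k ell2" is
  "\<lambda>lam x i. if bounded (range lam) then of_real (lam i) * x i else 0"
proof -
  fix lam :: "nat \<Rightarrow> real" and x :: "nat \<Rightarrow> 'k"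
  assume x: "summable (\<lambda>i. (norm (x i))\<^sup>2)"
  show "summable (\<lambda>i. (norm (if bounded (range lam) then of_real (lam i) * x i else 0))\<^sup>2)"
  proof (cases "bounded (range lam)")
    case True
    obtain C where C: "C \<ge> 0" "\<And>i. \<bar>lam i\<bar> \<le> C"
      using bounded_range_real[OF True] by blast
    from square_summable_diag(1)[OF C(2) x] True show ?thesis by simp
  qed simp
qed

lift_definition diag_op :: "(nat \<Rightarrow> real) \<Rightarrow> 'k::hilbert_scalar ell2 \<Rightarrow>\<^sub>L 'k ell2" is diag_ell2
proof -
  fix lam :: "nat \<Rightarrow> real"
  show "bounded_linear (diag_ell2 lam :: 'k ell2 \<Rightarrow> 'k ell2)"
  proof (cases "bounded (range lam)")
    case False
    then have "(diag_ell2 lam :: 'k ell2 \<Rightarrow> 'k ell2) = (\<lambda>x. 0)"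
      by (intro ext ell2_eqI) (simp add: diag_ell2.rep_eq)
    then show ?thesis by simp
  next
    case True
    obtain C where C: "C \<ge> 0" "\<And>i. \<bar>lam i\<bar> \<le> C"
      using bounded_range_real[OF True] by blast
    have co: "coord (diag_ell2 lam x) i = of_real (lam i) * coord x i" for x :: "'k ell2" and i
      using True by (simp add: diag_ell2.rep_eq)
    show ?thesis
    proof (rule bounded_linear_intro[where K = C])
      fix x y :: "'k ell2" and r :: real
      show "diag_ell2 lam (x + y) = diag_ell2 lam x + diag_ell2 lam y"
        by (rule ell2_eqI) (simp add: co distrib_left)
      show "diag_ell2 lam (r *\<^sub>R x) = r *\<^sub>R diag_ell2 lam x"
        by (rule ell2_eqI) (simp add: co)
      have "(norm (diag_ell2 lam x))\<^sup>2 \<le> (norm x * C)\<^sup>2"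
        using square_summable_diag(2)[OF C(2) summable_coord[of x]]
        by (simp add: norm_ell2_sq power_mult_distrib co mult.commute)
      then show "norm (diag_ell2 lam x) \<le> norm x * C"
        by (rule power2_le_imp_le) (use C in simp)
    qed
  qed
qed

lemma coord_diag_op:
  assumes "bounded (range lam)"
  shows "coord (blinfun_apply (diag_op lam) x) i = of_real (lam i) * coord x i"
  using assms by (simp add: diag_op.rep_eq diag_ell2.rep_eq)

lemma has_matrix_diag_op:
  assumes "bounded (range lam)"
  shows "has_matrix (diag_op lam) (\<lambda>i j. if i = j then lam i else 0)"
  unfolding has_matrix_def scalar_linear_def
  by (auto intro!: ell2_eqI simp: coord_diag_op[OF assms] scale_ell2.rep_eq unit_ell2.rep_eq)


subsection \<open>Matrices and graphs\<close>

text \<open>Indices start at 0: the entry in row \<open>i + 1\<close> and column \<open>j + 1\<close> of a matrix \<open>A\<close> is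
  \<open>A $$ (i, j)\<close>, the vertices are the natural numbers including 0, and the induced subgraph on the
  first \<open>n\<close> vertices has the vertex set \<open>{..<n}\<close>. A graph is given by its adjacency relation.\<close>

definition simple_graph :: "nat rel \<Rightarrow> bool" where
  "simple_graph G \<longleftrightarrow> sym G \<and> irrefl G"

definition symmetric_mat :: "nat \<Rightarrow> real mat \<Rightarrow> bool" where
  "symmetric_mat n A \<longleftrightarrow> A \<in> carrier_mat n n \<and> transpose_mat A = A"

definition graph_of_mat_is :: "nat \<Rightarrow> real mat \<Rightarrow> nat rel \<Rightarrow> bool" where
  "graph_of_mat_is n A G \<longleftrightarrow> (\<forall>i<n. \<forall>j<n. i \<noteq> j \<longrightarrow> (A $$ (i, j) \<noteq> 0 \<longleftrightarrow> (i, j) \<in> G))"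

definition weak_spectral_property :: "nat \<Rightarrow> real mat \<Rightarrow> bool" where
  "weak_spectral_property n A \<longleftrightarrow>
     (\<forall>X. symmetric_mat n X \<and> (\<forall>i<n. X $$ (i, i) = 0) \<and> X * A - A * X = 0\<^sub>m n n \<longrightarrow> X = 0\<^sub>m n n)"

definition mat_op_norm :: "real mat \<Rightarrow> real" where
  "mat_op_norm A = Sup {sqrt (scalar_prod (A *\<^sub>v x) (A *\<^sub>v x)) | x.
     x \<in> carrier_vec (dim_col A) \<and> sqrt (scalar_prod x x) \<le> 1}"

definition append_diag :: "nat \<Rightarrow> real mat \<Rightarrow> real \<Rightarrow> real mat" where
  "append_diag n A c = four_block_mat A (0\<^sub>m n 1) (0\<^sub>m 1 n) (mat 1 1 (\<lambda>_. c))"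

text \<open>\<open>A \<oplus> diag(lam n, lam (n + 1), \<dots>)\<close> for an \<open>n \<times> n\<close> matrix \<open>A\<close>.\<close>

definition extend_diag :: "nat \<Rightarrow> real mat \<Rightarrow> (nat \<Rightarrow> real) \<Rightarrow> nat \<Rightarrow> nat \<Rightarrow> real" where
  "extend_diag n A lam i j =
     (if i < n \<and> j < n then A $$ (i, j) else if i = j then lam i else 0)"


subsection \<open>Constructed solutions\<close>

definition dense_enumeration :: "(nat \<Rightarrow> real) \<Rightarrow> real set \<Rightarrow> bool" where
  "dense_enumeration lam \<Lambda> \<longleftrightarrow> inj lam \<and> range lam \<subseteq> \<Lambda> \<and> \<Lambda> \<subseteq> closure (range lam)"

text \<open>\<open>A n\<close> is the \<open>n\<close>-th matrix for \<open>n \<ge> 1\<close>; the value \<open>A 0\<close> is irrelevant. The element added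
  to the spectrum in passing from \<open>A n\<close> to \<open>A (n + 1)\<close> is \<open>lam n\<close>.\<close>

definition approximating_matrices ::
    "nat rel \<Rightarrow> (nat \<Rightarrow> real) \<Rightarrow> (nat \<Rightarrow> real mat) \<Rightarrow> bool" where
  "approximating_matrices G lam A \<longleftrightarrow>
     A 1 = mat 1 1 (\<lambda>_. lam 0) \<and>
     (\<forall>n\<ge>1.
        symmetric_mat n (A n) \<and>
        graph_of_mat_is n (A n) G \<and>
        spectrum (A n) = lam ` {..<n} \<and>
        weak_spectral_property n (A n) \<and>
        (\<forall>i<n. \<forall>j<n. i \<noteq> j \<longrightarrow> A (Suc n) $$ (i, j) = A n $$ (i, j)) \<and>
        mat_op_norm (append_diag n (A n) (lam n) - A (Suc n)) < 1 / 2 ^ n)"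

definition constructed_solution ::
    "nat rel \<Rightarrow> real set \<Rightarrow> ('k::hilbert_scalar ell2 \<Rightarrow>\<^sub>L 'k ell2) \<Rightarrow> bool" where
  "constructed_solution G \<Lambda> T \<longleftrightarrow>
     (\<exists>lam A Tn.
        dense_enumeration lam \<Lambda> \<and>
        approximating_matrices G lam A \<and>
        (\<forall>n\<ge>1. has_matrix (Tn n) (extend_diag n (A n) lam)) \<and>
        Tn \<longlonglongrightarrow> T)"

end

theory Submission
  imports Defs
begin

text \<open>
  Every constructed solution is approximately unitarily equivalent to a diagonal operator, and
  the diagonal operators that arise are approximately unitarily equivalent to one another.

  The first half rests on the spectral theorem. The matrix \<open>A n\<close> is symmetric of size \<open>n\<close> and has the
  \<open>n\<close> different eigenvalues \<open>lam 0, \<dots>, lam (n - 1)\<close>, so an orthogonal matrix diagonalises it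
  (\<open>symmetric_mat_diagonalization\<close>). Padded with an identity block, this matrix becomes a unitary
  operator that carries \<open>A n \<oplus> diag (lam n, \<dots>)\<close> to \<open>diag lam\<close>: every term of the sequence whose
  limit is the constructed solution is unitarily equivalent to the same diagonal operator
  (\<open>constructed_solution_approx_diag\<close>).

  The second half is the combinatorial core of the Weyl--von Neumann--Berg theorem. Two dense
  enumerations \<open>lam\<close> and \<open>mu\<close> of a compact set can, for every \<open>e > 0\<close>, be matched by a permutation
  \<open>p\<close> of the indices such that \<open>\<bar>lam i - mu (p i)\<bar> < e\<close> for all \<open>i\<close> (\<open>dense_enumerations_matching\<close>).
  The unitary operator that permutes the basis vectors by \<open>p\<close> then carries one diagonal operator to
  within \<open>e\<close> of the other. Points with finitely many neighbours in an \<open>e\<close>-ball are isolated, hence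
  occur in both enumerations, and there are only finitely many of them; each remaining point has
  infinitely many partners to choose from. This gives injections in both directions, and a
  Cantor--Bernstein argument that retains the two injections merges them into a permutation.
\<close>

section \<open>Approximate unitary equivalence is an equivalence relation\<close>

lemma unitary_inverse_apply:
  assumes "unitary_with_adjoint U V"
  shows "blinfun_apply V (blinfun_apply U x) = x" "blinfun_apply U (blinfun_apply V x) = x"
  using assms unfolding unitary_with_adjoint_def
  by (metis blinfun_apply_blinfun_compose id_blinfun.rep_eq)+

lemma unitary_norm:
  assumes "unitary_with_adjoint U V"
  shows "norm (blinfun_apply U x) = norm x"
proof -
  have "inner (blinfun_apply U x) (blinfun_apply U x) = inner x x"
    using assms unitary_inverse_apply(1)[OF assms]
    by (simp add: unitary_with_adjoint_def is_adjoint_def)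
  then show ?thesis by (simp add: norm_eq)
qed

lemma unitary_with_adjoint_swap:
  assumes "unitary_with_adjoint U V"
  shows "unitary_with_adjoint V U"
proof -
  have "scalar_linear V"
    unfolding scalar_linear_def
  proof (intro allI)
    fix c x
    have "blinfun_apply V (scale_ell2 c x)
        = blinfun_apply V (scale_ell2 c (blinfun_apply U (blinfun_apply V x)))"
      by (simp add: unitary_inverse_apply[OF assms])
    also have "\<dots> = blinfun_apply V (blinfun_apply U (scale_ell2 c (blinfun_apply V x)))"
      using assms by (simp add: unitary_with_adjoint_def scalar_linear_def)
    finally show "blinfun_apply V (scale_ell2 c x) = scale_ell2 c (blinfun_apply V x)"
      by (simp add: unitary_inverse_apply[OF assms])
  qed
  moreover have "is_adjoint U V"
    using assms unfolding unitary_with_adjoint_def is_adjoint_def by (metis inner_commute)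
  ultimately show ?thesis
    using assms by (simp add: unitary_with_adjoint_def)
qed

lemma unitary_with_adjoint_compose:
  assumes "unitary_with_adjoint U1 V1" "unitary_with_adjoint U2 V2"
  shows "unitary_with_adjoint (U2 o\<^sub>L U1) (V1 o\<^sub>L V2)"
proof -
  have "V1 o\<^sub>L V2 o\<^sub>L (U2 o\<^sub>L U1) = id_blinfun" "U2 o\<^sub>L U1 o\<^sub>L (V1 o\<^sub>L V2) = id_blinfun"
    by (auto intro!: blinfun_eqI simp: unitary_inverse_apply[OF assms(1)]
        unitary_inverse_apply[OF assms(2)])
  then show ?thesis
    using assms by (simp add: unitary_with_adjoint_def scalar_linear_def is_adjoint_def)
qed

lemma norm_unitary_conjugate_le:
  assumes "unitary_with_adjoint U V"
  shows "norm (V o\<^sub>L X o\<^sub>L U) \<le> norm X"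
proof (rule norm_blinfun_bound)
  fix x
  have "norm (blinfun_apply (V o\<^sub>L X o\<^sub>L U) x) = norm (blinfun_apply X (blinfun_apply U x))"
    by (simp add: unitary_norm[OF unitary_with_adjoint_swap[OF assms]])
  also have "\<dots> \<le> norm X * norm x"
    using norm_blinfun[of X "blinfun_apply U x"] by (simp add: unitary_norm[OF assms])
  finally show "norm (blinfun_apply (V o\<^sub>L X o\<^sub>L U) x) \<le> norm X * norm x" .
qed simp

text \<open>The formulation with \<open>e\<close> lets the unitaries be produced for each accuracy separately, and
  turns symmetry and transitivity into triangle inequalities.\<close>

lemma approx_unitarily_equiv_iff:
  "T1 \<sim>\<^sub>a T2 \<longleftrightarrow> (\<forall>e>0. \<exists>U V. unitary_with_adjoint U V \<and> norm ((V o\<^sub>L T2 o\<^sub>L U) - T1) < e)"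
proof
  assume "T1 \<sim>\<^sub>a T2"
  then obtain U V where UV: "\<And>n. unitary_with_adjoint (U n) (V n)"
    and lim: "(\<lambda>n. V n o\<^sub>L T2 o\<^sub>L U n) \<longlonglongrightarrow> T1"
    unfolding approx_unitarily_equiv_def by blast
  show "\<forall>e>0. \<exists>U V. unitary_with_adjoint U V \<and> norm ((V o\<^sub>L T2 o\<^sub>L U) - T1) < e"
    using LIMSEQ_D[OF lim] UV by blast
next
  assume *: "\<forall>e>0. \<exists>U V. unitary_with_adjoint U V \<and> norm ((V o\<^sub>L T2 o\<^sub>L U) - T1) < e"
  have "\<forall>n. \<exists>U V. unitary_with_adjoint U V \<and>
      norm ((V o\<^sub>L T2 o\<^sub>L U) - T1) < inverse (real (Suc n))"
    using * by (meson inverse_positive_iff_positive of_nat_0_less_iff zero_less_Suc)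
  then obtain U V where UV: "\<And>n. unitary_with_adjoint (U n) (V n)"
    and le: "\<And>n. norm ((V n o\<^sub>L T2 o\<^sub>L U n) - T1) < inverse (real (Suc n))"
    by metis
  have "(\<lambda>n. (V n o\<^sub>L T2 o\<^sub>L U n) - T1) \<longlonglongrightarrow> 0"
    by (rule Lim_null_comparison[OF _ LIMSEQ_inverse_real_of_nat])
      (use le in \<open>simp add: less_imp_le always_eventually del: of_nat_Suc\<close>)
  then show "T1 \<sim>\<^sub>a T2"
    unfolding approx_unitarily_equiv_def using UV LIM_zero_iff by blast
qed

lemma approx_unitarily_equiv_sym:
  assumes "T1 \<sim>\<^sub>a T2"
  shows "T2 \<sim>\<^sub>a T1"
  unfolding approx_unitarily_equiv_iff
proof (intro allI impI)
  fix e :: real assume "e > 0"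
  then obtain U V where UV: "unitary_with_adjoint U V" and less: "norm ((V o\<^sub>L T2 o\<^sub>L U) - T1) < e"
    using assms unfolding approx_unitarily_equiv_iff by blast
  have "(U o\<^sub>L T1 o\<^sub>L V) - T2 = - (U o\<^sub>L ((V o\<^sub>L T2 o\<^sub>L U) - T1) o\<^sub>L V)"
    by (rule blinfun_eqI) (simp add: blinfun.bilinear_simps unitary_inverse_apply[OF UV])
  then have "norm ((U o\<^sub>L T1 o\<^sub>L V) - T2) < e"
    using norm_unitary_conjugate_le[OF unitary_with_adjoint_swap[OF UV], of "(V o\<^sub>L T2 o\<^sub>L U) - T1"]
      less by simp
  then show "\<exists>U V. unitary_with_adjoint U V \<and> norm ((V o\<^sub>L T1 o\<^sub>L U) - T2) < e"
    using unitary_with_adjoint_swap[OF UV] by blast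
qed

lemma approx_unitarily_equiv_trans:
  assumes "T1 \<sim>\<^sub>a T2" "T2 \<sim>\<^sub>a T3"
  shows "T1 \<sim>\<^sub>a T3"
  unfolding approx_unitarily_equiv_iff
proof (intro allI impI)
  fix e :: real assume "e > 0"
  then have "e / 2 > 0" by simp
  obtain U1 V1 where 1: "unitary_with_adjoint U1 V1" "norm ((V1 o\<^sub>L T2 o\<^sub>L U1) - T1) < e / 2"
    using assms(1) \<open>e / 2 > 0\<close> unfolding approx_unitarily_equiv_iff by blast
  obtain U2 V2 where 2: "unitary_with_adjoint U2 V2" "norm ((V2 o\<^sub>L T3 o\<^sub>L U2) - T2) < e / 2"
    using assms(2) \<open>e / 2 > 0\<close> unfolding approx_unitarily_equiv_iff by blast
  have "((V1 o\<^sub>L V2) o\<^sub>L T3 o\<^sub>L (U2 o\<^sub>L U1)) - T1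
      = (V1 o\<^sub>L ((V2 o\<^sub>L T3 o\<^sub>L U2) - T2) o\<^sub>L U1) + ((V1 o\<^sub>L T2 o\<^sub>L U1) - T1)"
    by (rule blinfun_eqI) (simp add: blinfun.bilinear_simps)
  then have "norm (((V1 o\<^sub>L V2) o\<^sub>L T3 o\<^sub>L (U2 o\<^sub>L U1)) - T1)
      \<le> norm (V1 o\<^sub>L ((V2 o\<^sub>L T3 o\<^sub>L U2) - T2) o\<^sub>L U1) + norm ((V1 o\<^sub>L T2 o\<^sub>L U1) - T1)"
    by (metis norm_triangle_ineq)
  also have "\<dots> < e"
    using norm_unitary_conjugate_le[OF 1(1), of "(V2 o\<^sub>L T3 o\<^sub>L U2) - T2"] 1(2) 2(2) by linarith
  finally show "\<exists>U V. unitary_with_adjoint U V \<and> norm ((V o\<^sub>L T3 o\<^sub>L U) - T1) < e"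
    using unitary_with_adjoint_compose[OF 1(1) 2(1)] by blast
qed

section \<open>Unitary operators from isometries\<close>

text \<open>Polarization recovers the inner product from the norm, so a scalar-linear isometry with a
  right inverse \<open>v\<close> is unitary with adjoint \<open>v\<close>; linearity and boundedness of \<open>v\<close> come for free.\<close>

lemma unitary_from_isometry:
  fixes u v :: "'k::hilbert_scalar ell2 \<Rightarrow> 'k ell2"
  assumes add: "\<And>x y. u (x + y) = u x + u y"
    and scaleR: "\<And>r x. u (r *\<^sub>R x) = r *\<^sub>R u x"
    and scale: "\<And>c x. u (scale_ell2 c x) = scale_ell2 c (u x)"
    and isometry: "\<And>x. norm (u x) = norm x"
    and right_inverse: "\<And>y. u (v y) = y"
  obtains U V where "unitary_with_adjoint U V" "blinfun_apply U = u" "blinfun_apply V = v"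
proof -
  have u: "bounded_linear u"
    by (rule bounded_linear_intro[where K = 1]) (auto simp: add scaleR isometry)
  have inj: "x = y" if "u x = u y" for x y
  proof -
    have "u (x - y) = 0"
      using that by (simp add: linear_diff[OF bounded_linear.linear[OF u]])
    then show ?thesis using isometry[of "x - y"] by simp
  qed
  have left_inverse: "v (u x) = x" for x
    by (rule inj) (rule right_inverse)
  have v: "bounded_linear v"
  proof (rule bounded_linear_intro[where K = 1])
    show "v (x + y) = v x + v y" for x y
      by (rule inj) (simp add: add right_inverse)
    show "v (r *\<^sub>R x) = r *\<^sub>R v x" for r x
      by (rule inj) (simp add: scaleR right_inverse)
    show "norm (v x) \<le> norm x * 1" for x
      using isometry[of "v x"] by (simp add: right_inverse)
  qed
  have inner: "inner (u x) (u y) = inner x y" for x y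
    by (simp add: dot_norm isometry flip: add)
  have "inner (u x) y = inner x (v y)" for x y
    using inner[of x "v y"] by (simp add: right_inverse)
  then have "unitary_with_adjoint (Blinfun u) (Blinfun v)"
    unfolding unitary_with_adjoint_def scalar_linear_def is_adjoint_def
    by (auto intro!: blinfun_eqI simp: bounded_linear_Blinfun_apply u v scale left_inverse
        right_inverse)
  then show ?thesis
    using that bounded_linear_Blinfun_apply[OF u] bounded_linear_Blinfun_apply[OF v] by blast
qed

text \<open>Non-injective reindexing need not preserve square summability; it is given the dummy
  value 0.\<close>

lift_definition reindex_ell2 :: "(nat \<Rightarrow> nat) \<Rightarrow> 'k::hilbert_scalar ell2 \<Rightarrow> 'k ell2" is
  "\<lambda>p x i. if inj p then x (p i) else 0"
proof -
  fix p :: "nat \<Rightarrow> nat" and x :: "nat \<Rightarrow> 'k"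
  assume "summable (\<lambda>i. (norm (x i))\<^sup>2)"
  from summable_reindex[OF this, of p]
  show "summable (\<lambda>i. (norm (if inj p then x (p i) else 0))\<^sup>2)"
    by (cases "inj p") (auto simp: o_def)
qed

lemma unitary_permutation:
  fixes p :: "nat \<Rightarrow> nat"
  assumes "bij p"
  obtains U V :: "'k::hilbert_scalar ell2 \<Rightarrow>\<^sub>L 'k ell2" where "unitary_with_adjoint U V"
    "\<And>x i. coord (blinfun_apply U x) i = coord x (inv_into UNIV p i)"
    "\<And>x i. coord (blinfun_apply V x) i = coord x (p i)"
proof -
  have p: "inj p" "surj p" and q: "inj (inv_into UNIV p)"
    using assms bij_imp_bij_inv[OF assms] by (auto simp: bij_def)
  let ?u = "reindex_ell2 (inv_into UNIV p) :: 'k ell2 \<Rightarrow> 'k ell2"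
  let ?v = "reindex_ell2 p :: 'k ell2 \<Rightarrow> 'k ell2"
  have u: "coord (?u x) i = coord x (inv_into UNIV p i)" for x i
    using q by (simp add: reindex_ell2.rep_eq)
  have v: "coord (?v x) i = coord x (p i)" for x i
    using p by (simp add: reindex_ell2.rep_eq)
  have norm: "norm (?u x) = norm x" for x
  proof -
    have "surj (inv_into UNIV p)" using p(1) by (rule inj_imp_surj_inv)
    then have "(\<Sum>i. (norm (coord x (inv_into UNIV p i)))\<^sup>2) = (\<Sum>i. (norm (coord x i))\<^sup>2)"
      using suminf_reindex[OF summable_coord[of x] q] by (simp add: o_def)
    then have "(norm (?u x))\<^sup>2 = (norm x)\<^sup>2"
      by (simp add: norm_ell2_sq u)
    then show ?thesis by simp
  qed
  show ?thesis
  proof (rule unitary_from_isometry[of ?u ?v])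
    show "?u (x + y) = ?u x + ?u y" for x y by (rule ell2_eqI) (simp add: u)
    show "?u (r *\<^sub>R x) = r *\<^sub>R ?u x" for r x by (rule ell2_eqI) (simp add: u)
    show "?u (scale_ell2 c x) = scale_ell2 c (?u x)" for c x
      by (rule ell2_eqI) (simp add: u scale_ell2.rep_eq)
    show "norm (?u x) = norm x" for x by (rule norm)
    show "?u (?v y) = y" for y by (rule ell2_eqI) (simp add: u v surj_f_inv_f[OF p(2)])
  qed (use u v that in auto)
qed

text \<open>The operator \<open>Q \<oplus> I\<close>, where the block \<open>Q\<close> acts on the first \<open>n\<close> coordinates.\<close>

lift_definition block_ell2 ::
    "nat \<Rightarrow> (nat \<Rightarrow> nat \<Rightarrow> real) \<Rightarrow> 'k::hilbert_scalar ell2 \<Rightarrow> 'k ell2" is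
  "\<lambda>n Q x i. if i < n then \<Sum>j<n. Q i j *\<^sub>R x j else x i"
proof -
  fix n and Q :: "nat \<Rightarrow> nat \<Rightarrow> real" and x :: "nat \<Rightarrow> 'k"
  assume *: "summable (\<lambda>i. (norm (x i))\<^sup>2)"
  have "eventually (\<lambda>i. (norm (if i < n then \<Sum>j<n. Q i j *\<^sub>R x j else x i))\<^sup>2 = (norm (x i))\<^sup>2)
      sequentially"
    using eventually_ge_at_top[of n] by eventually_elim auto
  from summable_cong[OF this] *
  show "summable (\<lambda>i. (norm (if i < n then \<Sum>j<n. Q i j *\<^sub>R x j else x i))\<^sup>2)" by blast
qed

lemma sum_delta_scaleR:
  fixes f :: "nat \<Rightarrow> 'a::real_vector"
  assumes "i < n"
  shows "(\<Sum>j<n. (if i = j then 1 else 0) *\<^sub>R f j) = f i"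
proof -
  have "(\<Sum>j<n. (if i = j then 1 else 0) *\<^sub>R f j) = (\<Sum>j<n. if i = j then f j else 0)"
    by (rule sum.cong) auto
  then show ?thesis using assms by simp
qed

lemma block_sum_compose:
  fixes x :: "nat \<Rightarrow> 'a::real_vector"
  assumes "\<And>i j. i < n \<Longrightarrow> j < n \<Longrightarrow> (\<Sum>k<n. P i k * R k j) = (if i = j then 1 else 0)" "i < n"
  shows "(\<Sum>k<n. P i k *\<^sub>R (\<Sum>j<n. R k j *\<^sub>R x j)) = x i"
proof -
  have "(\<Sum>k<n. P i k *\<^sub>R (\<Sum>j<n. R k j *\<^sub>R x j)) = (\<Sum>k<n. \<Sum>j<n. (P i k * R k j) *\<^sub>R x j)"
    by (simp add: scaleR_sum_right)
  also have "\<dots> = (\<Sum>j<n. (\<Sum>k<n. P i k * R k j) *\<^sub>R x j)"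
    by (subst sum.swap) (simp add: scaleR_sum_left)
  also have "\<dots> = (\<Sum>j<n. (if i = j then 1 else 0) *\<^sub>R x j)"
    by (rule sum.cong) (use assms in auto)
  finally show ?thesis using sum_delta_scaleR[OF assms(2)] by metis
qed

lemma unitary_block:
  fixes Q :: "nat \<Rightarrow> nat \<Rightarrow> real"
  assumes rows: "\<And>i j. i < n \<Longrightarrow> j < n \<Longrightarrow> (\<Sum>k<n. Q i k * Q j k) = (if i = j then 1 else 0)"
    and cols: "\<And>i j. i < n \<Longrightarrow> j < n \<Longrightarrow> (\<Sum>k<n. Q k i * Q k j) = (if i = j then 1 else 0)"
  obtains U V :: "'k::hilbert_scalar ell2 \<Rightarrow>\<^sub>L 'k ell2" where "unitary_with_adjoint U V"
    "\<And>x i. coord (blinfun_apply U x) i = (if i < n then \<Sum>j<n. Q i j *\<^sub>R coord x j else coord x i)"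
    "\<And>x i. coord (blinfun_apply V x) i = (if i < n then \<Sum>j<n. Q j i *\<^sub>R coord x j else coord x i)"
proof -
  let ?u = "block_ell2 n Q :: 'k ell2 \<Rightarrow> 'k ell2"
  let ?v = "block_ell2 n (\<lambda>i j. Q j i) :: 'k ell2 \<Rightarrow> 'k ell2"
  note u = block_ell2.rep_eq[of n Q]
  note v = block_ell2.rep_eq[of n "\<lambda>i j. Q j i"]
  have norm: "norm (?u x) = norm x" for x
  proof -
    have "(\<Sum>i<n. (norm (coord (?u x) i))\<^sup>2)
        = (\<Sum>i<n. \<Sum>j<n. inner (coord x j) (Q i j *\<^sub>R (\<Sum>l<n. Q i l *\<^sub>R coord x l)))"
      by (rule sum.cong) (auto simp: u power2_norm_eq_inner inner_sum_left)
    also have "\<dots> = (\<Sum>j<n. inner (coord x j) (\<Sum>i<n. Q i j *\<^sub>R (\<Sum>l<n. Q i l *\<^sub>R coord x l)))"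
      by (subst sum.swap) (simp add: inner_sum_right)
    also have "\<dots> = (\<Sum>j<n. (norm (coord x j))\<^sup>2)"
    proof (rule sum.cong)
      fix j assume "j \<in> {..<n}"
      then show "inner (coord x j) (\<Sum>i<n. Q i j *\<^sub>R (\<Sum>l<n. Q i l *\<^sub>R coord x l))
          = (norm (coord x j))\<^sup>2"
        using block_sum_compose[of n "\<lambda>j i. Q i j" Q j "coord x"] cols
        by (simp add: power2_norm_eq_inner)
    qed simp
    finally have "(norm (?u x))\<^sup>2 = (norm x)\<^sup>2"
      unfolding norm_ell2_sq
      using suminf_split_initial_segment[OF summable_coord[of "?u x"], of n]
        suminf_split_initial_segment[OF summable_coord[of x], of n]
      by (simp add: u)
    then show ?thesis by simp
  qed
  show ?thesis
  proof (rule unitary_from_isometry[of ?u ?v])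
    show "?u (x + y) = ?u x + ?u y" for x y
      by (rule ell2_eqI) (simp add: u scaleR_add_right sum.distrib)
    show "?u (r *\<^sub>R x) = r *\<^sub>R ?u x" for r x
      by (rule ell2_eqI) (simp add: u scaleR_sum_right mult.commute)
    show "?u (scale_ell2 c x) = scale_ell2 c (?u x)" for c x
      by (rule ell2_eqI) (simp add: u scale_ell2.rep_eq sum_distrib_left)
    show "norm (?u x) = norm x" for x by (rule norm)
    show "?u (?v y) = y" for y
    proof (rule ell2_eqI)
      fix i
      show "coord (?u (?v y)) i = coord y i"
        using block_sum_compose[of n Q "\<lambda>i j. Q j i" i "coord y"] rows by (simp add: u v)
    qed
  next
    fix U V :: "'k ell2 \<Rightarrow>\<^sub>L 'k ell2"
    assume "unitary_with_adjoint U V" "blinfun_apply U = ?u" "blinfun_apply V = ?v"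
    then show thesis using that[of U V] by (simp only: u v)
  qed
qed

section \<open>Operators are determined by their matrices\<close>

lemma truncation_tendsto:
  fixes x :: "'k::hilbert_scalar ell2"
  shows "(\<lambda>m. \<Sum>j<m. scale_ell2 (coord x j) (unit_ell2 j)) \<longlonglongrightarrow> x"
proof -
  let ?t = "\<lambda>m. \<Sum>j<m. scale_ell2 (coord x j) (unit_ell2 j)"
  have t: "coord (?t m) i = (if i < m then coord x i else 0)" for m i
    by (induction m) (auto simp: scale_ell2.rep_eq unit_ell2.rep_eq less_Suc_eq)
  have sq: "(norm (x - ?t m))\<^sup>2 = (\<Sum>i. (norm (coord x i))\<^sup>2) - (\<Sum>i<m. (norm (coord x i))\<^sup>2)" for m
    unfolding norm_ell2_sq
    using suminf_split_initial_segment[OF summable_coord[of "x - ?t m"], of m]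
      suminf_split_initial_segment[OF summable_coord[of x], of m]
    by (simp add: t)
  have "(\<lambda>m. (\<Sum>i. (norm (coord x i))\<^sup>2) - (\<Sum>i<m. (norm (coord x i))\<^sup>2)) \<longlonglongrightarrow> 0"
    using tendsto_diff[OF tendsto_const[of "\<Sum>i. (norm (coord x i))\<^sup>2"]
        summable_LIMSEQ[OF summable_coord[of x]]] by simp
  then have "(\<lambda>m. (norm (x - ?t m))\<^sup>2) \<longlonglongrightarrow> 0"
    unfolding sq .
  from tendsto_real_sqrt[OF this] have "(\<lambda>m. norm (x - ?t m)) \<longlonglongrightarrow> 0"
    by simp
  then have "(\<lambda>m. x - ?t m) \<longlonglongrightarrow> 0"
    by (rule tendsto_norm_zero_cancel)
  from tendsto_diff[OF tendsto_const[of x] this] show ?thesis by simp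
qed

lemma has_matrix_unique:
  fixes S T :: "'k::hilbert_scalar ell2 \<Rightarrow>\<^sub>L 'k ell2"
  assumes "has_matrix S M" "has_matrix T M"
  shows "S = T"
proof (rule blinfun_eqI)
  fix x :: "'k ell2"
  let ?t = "\<lambda>m. \<Sum>j<m. scale_ell2 (coord x j) (unit_ell2 j) :: 'k ell2"
  have unit: "blinfun_apply S (unit_ell2 j) = blinfun_apply T (unit_ell2 j)" for j
    by (rule ell2_eqI) (use assms in \<open>simp add: has_matrix_def\<close>)
  have "blinfun_apply S (?t m) = blinfun_apply T (?t m)" for m
    using assms by (simp add: blinfun.sum_right has_matrix_def scalar_linear_def unit)
  moreover have "(\<lambda>m. blinfun_apply S (?t m)) \<longlonglongrightarrow> blinfun_apply S x"
    "(\<lambda>m. blinfun_apply T (?t m)) \<longlonglongrightarrow> blinfun_apply T x"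
    by (intro blinfun.tendsto tendsto_const truncation_tendsto)+
  ultimately show "blinfun_apply S x = blinfun_apply T x"
    using LIMSEQ_unique by fastforce
qed

section \<open>Diagonalizing symmetric matrices with simple spectrum\<close>

text \<open>Eigenvectors of a symmetric matrix to different eigenvalues are orthogonal, so \<open>n\<close> different
  eigenvalues already give an orthonormal basis of eigenvectors: it forms the rows of \<open>Q\<close>.\<close>

lemma symmetric_mat_diagonalization:
  fixes lam :: "nat \<Rightarrow> real"
  assumes sym: "symmetric_mat n A"
    and spec: "spectrum A = lam ` {..<n}"
    and inj: "inj_on lam {..<n}"
  obtains Q :: "nat \<Rightarrow> nat \<Rightarrow> real" where
    "\<And>i j. i < n \<Longrightarrow> j < n \<Longrightarrow> (\<Sum>k<n. Q i k * Q j k) = (if i = j then 1 else 0)"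
    "\<And>i j. i < n \<Longrightarrow> j < n \<Longrightarrow> (\<Sum>k<n. Q k i * Q k j) = (if i = j then 1 else 0)"
    "\<And>i j. i < n \<Longrightarrow> j < n \<Longrightarrow> A $$ (i, j) = (\<Sum>k<n. Q k i * (lam k * Q k j))"
proof -
  have A: "A \<in> carrier_mat n n" and At: "A\<^sup>T = A"
    using sym by (auto simp: symmetric_mat_def)
  have A_sym: "A $$ (j, i) = A $$ (i, j)" if "i < n" "j < n" for i j
    using that A At by (metis carrier_matD index_transpose_mat(1))
  have "\<forall>k. \<exists>v. k < n \<longrightarrow> eigenvector A v (lam k)"
    using spec unfolding spectrum_def eigenvalue_def by blast
  then obtain v where v: "\<And>k. k < n \<Longrightarrow> eigenvector A (v k) (lam k)"
    by metis
  have v_eq: "(\<Sum>j<n. A $$ (i, j) * v k $ j) = lam k * v k $ i" if "i < n" "k < n" for i k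
  proof -
    have "v k \<in> carrier_vec n" "(A *\<^sub>v v k) $ i = (lam k \<cdot>\<^sub>v v k) $ i"
      using v[OF \<open>k < n\<close>] A by (auto simp: eigenvector_def)
    then show ?thesis
      using A \<open>i < n\<close> by (simp add: scalar_prod_def lessThan_atLeast0)
  qed
  have orth: "(\<Sum>j<n. v k $ j * v l $ j) = 0" if "k < n" "l < n" "k \<noteq> l" for k l
  proof -
    have "lam k * (\<Sum>i<n. v k $ i * v l $ i) = (\<Sum>i<n. (\<Sum>j<n. A $$ (i, j) * v k $ j) * v l $ i)"
      using that by (simp add: v_eq sum_distrib_left mult.assoc)
    also have "\<dots> = (\<Sum>j<n. \<Sum>i<n. A $$ (i, j) * v k $ j * v l $ i)"
      by (subst sum.swap) (simp add: sum_distrib_right)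
    also have "\<dots> = (\<Sum>j<n. v k $ j * (\<Sum>i<n. A $$ (j, i) * v l $ i))"
      by (intro sum.cong refl) (auto simp: sum_distrib_left A_sym mult_ac)
    also have "\<dots> = (\<Sum>j<n. v k $ j * (lam l * v l $ j))"
      using that by (simp add: v_eq)
    also have "\<dots> = lam l * (\<Sum>i<n. v k $ i * v l $ i)"
      by (simp add: sum_distrib_left mult_ac)
    finally have "(lam k - lam l) * (\<Sum>i<n. v k $ i * v l $ i) = 0"
      by (simp add: algebra_simps)
    moreover have "lam k \<noteq> lam l"
      using that inj by (auto simp: inj_on_def)
    ultimately show ?thesis by simp
  qed
  define s where "s k = (\<Sum>j<n. v k $ j * v k $ j)" for k
  have s: "s k > 0" if "k < n" for k
  proof -
    have vk: "v k \<in> carrier_vec n" "v k \<noteq> 0\<^sub>v n"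
      using v[OF that] A by (auto simp: eigenvector_def)
    then obtain i where "i < n" "v k $ i \<noteq> 0"
      by (metis carrier_vecD eq_vecI index_zero_vec)
    then show ?thesis
      unfolding s_def by (intro sum_pos2[of _ i]) (auto simp: zero_less_mult_iff linorder_neq_iff)
  qed
  define Q where "Q k i = v k $ i / sqrt (s k)" for k i
  have rows: "(\<Sum>k<n. Q i k * Q j k) = (if i = j then 1 else 0)" if "i < n" "j < n" for i j
  proof -
    have "(\<Sum>k<n. Q i k * Q j k) = (\<Sum>k<n. v i $ k * v j $ k) / (sqrt (s i) * sqrt (s j))"
      by (simp add: Q_def sum_divide_distrib)
    then show ?thesis
      using orth[OF that] s[OF that(1)] by (auto simp: s_def)
  qed
  have eq: "(\<Sum>j<n. Q k j * A $$ (j, i)) = lam k * Q k i" if "i < n" "k < n" for i k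
  proof -
    have "(\<Sum>j<n. Q k j * A $$ (j, i)) = (\<Sum>j<n. A $$ (i, j) * v k $ j) / sqrt (s k)"
      using that by (simp add: Q_def sum_divide_distrib A_sym mult.commute)
    then show ?thesis using v_eq[OF that] by (simp add: Q_def)
  qed
  define P where "P = mat n n (\<lambda>(i, j). Q i j)"
  have P: "P \<in> carrier_mat n n" by (simp add: P_def)
  have "P * P\<^sup>T = 1\<^sub>m n"
    by (rule eq_matI) (auto simp: P_def scalar_prod_def rows lessThan_atLeast0[symmetric])
  \<comment> \<open>A right inverse of a square matrix is a left inverse: orthonormal rows give orthonormal
    columns.\<close>
  then have PP: "P\<^sup>T * P = 1\<^sub>m n"
    using mat_mult_left_right_inverse[OF P] P by simp
  have cols: "(\<Sum>k<n. Q k i * Q k j) = (if i = j then 1 else 0)" if "i < n" "j < n" for i j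
  proof -
    have "(P\<^sup>T * P) $$ (i, j) = (\<Sum>k<n. Q k i * Q k j)"
      using that by (simp add: P_def scalar_prod_def lessThan_atLeast0[symmetric])
    then show ?thesis using that by (simp add: PP)
  qed
  have "A $$ (i, j) = (\<Sum>k<n. Q k i * (lam k * Q k j))" if "i < n" "j < n" for i j
  proof -
    have "(\<Sum>k<n. Q k i * (lam k * Q k j)) = (\<Sum>k<n. Q k i *\<^sub>R (\<Sum>l<n. Q k l *\<^sub>R A $$ (l, j)))"
      using that by (simp add: eq)
    also have "\<dots> = A $$ (i, j)"
      using block_sum_compose[of n "\<lambda>i k. Q k i" Q i "\<lambda>l. A $$ (l, j)"] cols that by simp
    finally show ?thesis by simp
  qed
  with rows cols that show ?thesis by blast
qed

section \<open>Constructed solutions are approximately diagonal\<close>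

lemma extend_diag_unitarily_diagonal:
  fixes T :: "'k::hilbert_scalar ell2 \<Rightarrow>\<^sub>L 'k ell2"
  assumes sym: "symmetric_mat n A" and spec: "spectrum A = lam ` {..<n}"
    and inj: "inj lam" and bdd: "bounded (range lam)"
    and T: "has_matrix T (extend_diag n A lam)"
  obtains U V where "unitary_with_adjoint U V" "T = V o\<^sub>L diag_op lam o\<^sub>L U"
proof -
  obtain Q where rows: "\<And>i j. i < n \<Longrightarrow> j < n \<Longrightarrow> (\<Sum>k<n. Q i k * Q j k) = (if i = j then 1 else 0)"
    and cols: "\<And>i j. i < n \<Longrightarrow> j < n \<Longrightarrow> (\<Sum>k<n. Q k i * Q k j) = (if i = j then 1 else 0)"
    and A: "\<And>i j. i < n \<Longrightarrow> j < n \<Longrightarrow> A $$ (i, j) = (\<Sum>k<n. Q k i * (lam k * Q k j))"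
    using symmetric_mat_diagonalization[OF sym spec inj_on_subset[OF inj subset_UNIV]] by blast
  obtain U V :: "'k ell2 \<Rightarrow>\<^sub>L 'k ell2" where UV: "unitary_with_adjoint U V"
    and U: "\<And>x i. coord (blinfun_apply U x) i
        = (if i < n then \<Sum>j<n. Q i j *\<^sub>R coord x j else coord x i)"
    and V: "\<And>x i. coord (blinfun_apply V x) i
        = (if i < n then \<Sum>j<n. Q j i *\<^sub>R coord x j else coord x i)"
    using unitary_block[of n Q] rows cols by blast
  have U_unit: "coord (blinfun_apply U (unit_ell2 j)) i
      = of_real (if i < n then if j < n then Q i j else 0 else if i = j then 1 else 0)" for i j
  proof -
    have "(\<Sum>l<n. Q i l *\<^sub>R (if l = j then 1 else 0 :: 'k)) = (\<Sum>l<n. if j = l then of_real (Q i l) else 0)"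
      by (rule sum.cong) (auto simp: of_real_def)
    then show ?thesis by (auto simp: U unit_ell2.rep_eq)
  qed
  have "has_matrix (V o\<^sub>L diag_op lam o\<^sub>L U) (extend_diag n A lam)"
    unfolding has_matrix_def
  proof (intro conjI allI)
    have "scalar_linear U" "scalar_linear V" "scalar_linear (diag_op lam :: 'k ell2 \<Rightarrow>\<^sub>L 'k ell2)"
      using UV unitary_with_adjoint_swap[OF UV] has_matrix_diag_op[OF bdd]
      by (auto simp: unitary_with_adjoint_def has_matrix_def)
    then show "scalar_linear (V o\<^sub>L diag_op lam o\<^sub>L U)"
      by (simp add: scalar_linear_def)
    fix i j
    show "coord (blinfun_apply (V o\<^sub>L diag_op lam o\<^sub>L U) (unit_ell2 j)) i
        = of_real (extend_diag n A lam i j)"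
      by (auto simp: V U_unit coord_diag_op[OF bdd] extend_diag_def A scaleR_conv_of_real)
  qed
  from has_matrix_unique[OF T this] UV that show ?thesis by blast
qed

lemma dense_enumeration_bounded:
  assumes "compact \<Lambda>" "dense_enumeration lam \<Lambda>"
  shows "bounded (range lam)"
  using assms compact_imp_bounded bounded_subset by (metis dense_enumeration_def)

lemma constructed_solution_approx_diag:
  assumes "compact \<Lambda>" "constructed_solution G \<Lambda> T"
  obtains lam where "dense_enumeration lam \<Lambda>" "T \<sim>\<^sub>a diag_op lam"
proof -
  obtain lam A Tn where dense: "dense_enumeration lam \<Lambda>" and A: "approximating_matrices G lam A"
    and Tn: "\<And>n. n \<ge> 1 \<Longrightarrow> has_matrix (Tn n) (extend_diag n (A n) lam)" and lim: "Tn \<longlonglongrightarrow> T"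
    using assms(2) unfolding constructed_solution_def by blast
  have bdd: "bounded (range lam)" and inj: "inj lam"
    using dense_enumeration_bounded[OF assms(1) dense] dense by (auto simp: dense_enumeration_def)
  have "T \<sim>\<^sub>a diag_op lam"
    unfolding approx_unitarily_equiv_iff
  proof (intro allI impI)
    fix e :: real assume "e > 0"
    then obtain N where N: "\<And>n. n \<ge> N \<Longrightarrow> norm (Tn n - T) < e"
      using LIMSEQ_D[OF lim] by blast
    define n where "n = max N 1"
    have "n \<ge> 1" "n \<ge> N" by (auto simp: n_def)
    have sym: "symmetric_mat n (A n)" and spec: "spectrum (A n) = lam ` {..<n}"
      using A \<open>n \<ge> 1\<close> by (simp_all add: approximating_matrices_def)
    obtain U V where "unitary_with_adjoint U V" "Tn n = V o\<^sub>L diag_op lam o\<^sub>L U"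
      using extend_diag_unitarily_diagonal[OF sym spec inj bdd Tn[OF \<open>n \<ge> 1\<close>]] .
    then show "\<exists>U V. unitary_with_adjoint U V \<and> norm ((V o\<^sub>L diag_op lam o\<^sub>L U) - T) < e"
      using N[OF \<open>n \<ge> N\<close>] by metis
  qed
  with dense that show ?thesis by blast
qed

section \<open>Matching dense enumerations\<close>

text \<open>The usual proof of the Cantor--Bernstein theorem gives more than a bijection: every pair of
  the bijection is a pair of one of the two injections, so it inherits any closeness that both of
  them have.\<close>

lemma Cantor_Bernstein_pointwise:
  fixes f :: "'a \<Rightarrow> 'b" and g :: "'b \<Rightarrow> 'a"
  assumes f: "inj f" and g: "inj g"
  obtains h where "bij h" "\<And>x. h x = f x \<or> g (h x) = x"
proof -
  define X where "X = lfp (\<lambda>X. - g ` (- f ` X))"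
  have "mono (\<lambda>X. - g ` (- f ` X))"
    by (rule monoI) blast
  from lfp_unfold[OF this] have X: "X = - g ` (- f ` X)"
    unfolding X_def .
  have g_X: "g y \<in> X \<longleftrightarrow> y \<in> f ` X" for y
    by (subst X) (simp add: inj_image_mem_iff[OF g])
  define h where "h x = (if x \<in> X then f x else inv_into UNIV g x)" for x
  have out: "\<exists>y. x = g y \<and> h x = y \<and> y \<notin> f ` X" if "x \<notin> X" for x
  proof -
    have "x \<in> g ` (- f ` X)" using X that by (metis ComplI)
    then obtain y where "x = g y" "y \<notin> f ` X" by blast
    then show ?thesis using that g by (auto simp: h_def)
  qed
  have h_image: "h x \<in> f ` X \<longleftrightarrow> x \<in> X" for x
    using out[of x] by (cases "x \<in> X") (auto simp: h_def)
  have "inj h"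
  proof (rule injI)
    fix x y assume eq: "h x = h y"
    show "x = y"
    proof (cases "x \<in> X")
      case True
      then have "y \<in> X" using h_image eq by metis
      with True show ?thesis using eq injD[OF f] by (simp add: h_def)
    next
      case False
      then have "y \<notin> X" using h_image eq by metis
      with False show ?thesis using out eq by metis
    qed
  qed
  moreover have "\<exists>x. h x = y" for y
  proof (cases "y \<in> f ` X")
    case True
    then show ?thesis by (auto simp: h_def)
  next
    case False
    then have "h (g y) = y" using g g_X by (simp add: h_def)
    then show ?thesis by blast
  qed
  ultimately have "bij h" unfolding bij_def surj_def by metis
  moreover have "h x = f x \<or> g (h x) = x" for x
    using out[of x] by (auto simp: h_def)
  ultimately show ?thesis using that by blast
qed

lemma inj_choice_infinite_sets:
  fixes J :: "nat \<Rightarrow> nat set"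
  assumes "\<And>i. infinite (J i)"
  obtains f where "inj f" "\<And>i. f i \<in> J i"
proof -
  have "\<exists>f. \<forall>n. f n \<in> J n \<and> f n < f (Suc n)"
  proof (rule dependent_nat_choice)
    show "\<exists>x. x \<in> J 0"
      using assms[of 0] infinite_imp_nonempty by blast
    show "\<exists>y. y \<in> J (Suc n) \<and> x < y" for x n
      using assms[of "Suc n"] unfolding infinite_nat_iff_unbounded by blast
  qed
  then obtain f where f: "\<And>n. f n \<in> J n" "\<And>n. f n < f (Suc n)" by blast
  then have "inj f" by (simp add: strict_mono_Suc_iff strict_mono_imp_inj_on)
  with f that show ?thesis by blast
qed

text \<open>A finite set is closed, so a dense enumeration with only finitely many values in a ball misses
  no point of \<open>\<Lambda>\<close> there. It follows both that isolated points are enumerated and that crowded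
  balls contain infinitely many values.\<close>

lemma dense_finite_ball:
  fixes x e :: real
  assumes dense: "dense_enumeration mu \<Lambda>" and fin: "finite (range mu \<inter> ball x e)"
  shows "\<Lambda> \<inter> ball x e \<subseteq> range mu \<inter> ball x e"
proof -
  have "ball x e \<inter> closure (range mu) \<subseteq> closure (ball x e \<inter> range mu)"
    by (intro open_Int_closure_subset open_ball)
  also have "\<dots> = range mu \<inter> ball x e"
    using fin by (simp add: Int_commute finite_imp_closed)
  finally show ?thesis
    using dense by (auto simp: dense_enumeration_def)
qed

text \<open>Crowded points cannot always be matched to themselves, since one enumeration may contain an
  accumulation point that the other omits. They are matched greedily instead, keeping clear of the
  finite set \<open>B\<close> of sparse points, each of which occurs in both enumerations and is matched to
  itself.\<close>

lemma dense_enumerations_injection: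
  fixes lam mu :: "nat \<Rightarrow> real"
  assumes "compact \<Lambda>" and lam: "dense_enumeration lam \<Lambda>" and mu: "dense_enumeration mu \<Lambda>"
    and "e > 0"
  obtains f where "inj f" "\<And>i. \<bar>lam i - mu (f i)\<bar> < e"
proof -
  define B where "B = {x \<in> \<Lambda>. finite (\<Lambda> \<inter> ball x e)}"
  have lam_in: "lam i \<in> \<Lambda>" and mu_in: "mu i \<in> \<Lambda>" for i
    using lam mu by (auto simp: dense_enumeration_def)
  have inj: "inj lam" "inj mu"
    using lam mu by (auto simp: dense_enumeration_def)
  have "finite B"
  proof (rule ccontr)
    assume "infinite B"
    moreover have "B \<subseteq> \<Lambda>" by (auto simp: B_def)
    \<comment> \<open>An accumulation point of \<open>B\<close> would have infinitely many points of \<open>\<Lambda>\<close> in its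
      \<open>e / 2\<close>-ball, and so would crowd every point of \<open>B\<close> in that ball, against the choice of \<open>B\<close>.\<close>
    ultimately obtain p where p: "p islimpt B"
      using \<open>compact \<Lambda>\<close> by (meson compact_eq_Bolzano_Weierstrass)
    have inf: "infinite (B \<inter> ball p (e / 2))"
      using p \<open>e > 0\<close> by (simp add: islimpt_eq_infinite_ball)
    then obtain x where x: "x \<in> B" "x \<in> ball p (e / 2)"
      using infinite_imp_nonempty by blast
    have "B \<inter> ball p (e / 2) \<subseteq> \<Lambda> \<inter> ball x e"
    proof
      fix y assume y: "y \<in> B \<inter> ball p (e / 2)"
      then have "dist x y < e"
        using x(2) by (metis IntD2 dist_triangle_half_r mem_ball)
      then show "y \<in> \<Lambda> \<inter> ball x e" using y \<open>B \<subseteq> \<Lambda>\<close> by auto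
    qed
    then show False
      using inf x(1) finite_subset unfolding B_def by blast
  qed
  have B_range: "x \<in> range mu" if "x \<in> B" for x
  proof -
    have "range mu \<inter> ball x e \<subseteq> \<Lambda> \<inter> ball x e"
      using mu_in by blast
    then have "finite (range mu \<inter> ball x e)"
      by (rule finite_subset) (use that in \<open>simp add: B_def\<close>)
    from dense_finite_ball[OF mu this] show ?thesis
      using that \<open>e > 0\<close> by (auto simp: B_def)
  qed
  define J where "J i = {j. lam i \<in> B \<or> mu j \<notin> B \<and> \<bar>lam i - mu j\<bar> < e}" for i
  have "infinite (J i)" for i
  proof (cases "lam i \<in> B")
    case True
    then show ?thesis by (simp add: J_def)
  next
    case False
    then have "infinite (\<Lambda> \<inter> ball (lam i) e)"
      using lam_in by (simp add: B_def)
    then have "infinite (range mu \<inter> ball (lam i) e)"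
      using dense_finite_ball[OF mu] finite_subset by blast
    then have "infinite (range mu \<inter> ball (lam i) e - B)"
      using \<open>finite B\<close> by simp
    moreover have "range mu \<inter> ball (lam i) e - B \<subseteq> mu ` J i"
      by (auto simp: J_def dist_real_def)
    ultimately show ?thesis
      using finite_subset by blast
  qed
  then obtain g where g: "inj g" "\<And>i. g i \<in> J i"
    using inj_choice_infinite_sets by blast
  define f where "f i = (if lam i \<in> B then inv_into UNIV mu (lam i) else g i)" for i
  have f_B: "mu (f i) = lam i" if "lam i \<in> B" for i
    using that B_range by (simp add: f_def f_inv_into_f)
  have f_not_B: "mu (f i) \<notin> B \<and> \<bar>lam i - mu (f i)\<bar> < e" if "lam i \<notin> B" for i
    using that g(2)[of i] by (simp add: f_def J_def)
  have "inj f"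
  proof (rule injI)
    fix i j assume eq: "f i = f j"
    show "i = j"
    proof (cases "lam i \<in> B")
      case True
      then have "lam j \<in> B" using f_B f_not_B eq by metis
      then show ?thesis using True f_B eq inj(1) by (metis injD)
    next
      case False
      then have "lam j \<notin> B" using f_B f_not_B eq by metis
      then show ?thesis using False eq injD[OF g(1)] by (simp add: f_def)
    qed
  qed
  moreover have "\<bar>lam i - mu (f i)\<bar> < e" for i
    using f_B[of i] f_not_B[of i] \<open>e > 0\<close> by (cases "lam i \<in> B") auto
  ultimately show ?thesis using that by blast
qed

lemma dense_enumerations_matching:
  fixes lam mu :: "nat \<Rightarrow> real"
  assumes "compact \<Lambda>" "dense_enumeration lam \<Lambda>" "dense_enumeration mu \<Lambda>" "e > 0"
  obtains p where "bij p" "\<And>i. \<bar>lam i - mu (p i)\<bar> < e"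
proof -
  obtain f where f: "inj f" "\<And>i. \<bar>lam i - mu (f i)\<bar> < e"
    using dense_enumerations_injection[OF assms] by blast
  obtain g where g: "inj g" "\<And>i. \<bar>mu i - lam (g i)\<bar> < e"
    using dense_enumerations_injection[OF assms(1,3,2,4)] by blast
  obtain p where p: "bij p" "\<And>i. p i = f i \<or> g (p i) = i"
    using Cantor_Bernstein_pointwise[OF f(1) g(1)] by blast
  have "\<bar>lam i - mu (p i)\<bar> < e" for i
    using p(2)[of i] f(2)[of i] g(2)[of "p i"] by (auto simp: abs_minus_commute)
  with p(1) that show ?thesis by blast
qed

lemma diag_op_approx_unitarily_equiv:
  assumes "compact \<Lambda>" and lam: "dense_enumeration lam \<Lambda>" and mu: "dense_enumeration mu \<Lambda>"
  shows "(diag_op lam :: 'k::hilbert_scalar ell2 \<Rightarrow>\<^sub>L 'k ell2) \<sim>\<^sub>a diag_op mu"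
  unfolding approx_unitarily_equiv_iff
proof (intro allI impI)
  fix e :: real assume "e > 0"
  then have "e / 2 > 0" by simp
  note bdd = dense_enumeration_bounded[OF assms(1) lam] dense_enumeration_bounded[OF assms(1) mu]
  obtain p where p: "bij p" "\<And>i. \<bar>lam i - mu (p i)\<bar> < e / 2"
    using dense_enumerations_matching[OF assms \<open>e / 2 > 0\<close>] by blast
  obtain U V :: "'k ell2 \<Rightarrow>\<^sub>L 'k ell2" where UV: "unitary_with_adjoint U V"
    and U: "\<And>x i. coord (blinfun_apply U x) i = coord x (inv_into UNIV p i)"
    and V: "\<And>x i. coord (blinfun_apply V x) i = coord x (p i)"
    using unitary_permutation[OF p(1)] by blast
  let ?D = "(V o\<^sub>L diag_op mu o\<^sub>L U) - diag_op lam"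
  have D: "coord (blinfun_apply ?D x) i = of_real (mu (p i) - lam i) * coord x i" for x i
    using p(1) by (simp add: blinfun.diff_left V U coord_diag_op[OF bdd(1)] coord_diag_op[OF bdd(2)]
        left_diff_distrib bij_is_inj)
  have "norm ?D \<le> e / 2"
  proof (rule norm_blinfun_bound)
    fix x
    have le: "\<bar>mu (p i) - lam i\<bar> \<le> e / 2" for i
      using p(2)[of i] by linarith
    have "(norm (blinfun_apply ?D x))\<^sup>2 \<le> (e / 2 * norm x)\<^sup>2"
      using square_summable_diag(2)[of "\<lambda>i. mu (p i) - lam i" "e / 2", OF le summable_coord[of x]]
      unfolding norm_ell2_sq D power_mult_distrib .
    then show "norm (blinfun_apply ?D x) \<le> e / 2 * norm x"
      by (rule power2_le_imp_le) (use \<open>e > 0\<close> in simp)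
  qed (use \<open>e > 0\<close> in simp)
  then have "norm ?D < e" using \<open>e > 0\<close> by linarith
  with UV show "\<exists>(U :: 'k ell2 \<Rightarrow>\<^sub>L 'k ell2) V. unitary_with_adjoint U V \<and>
      norm ((V o\<^sub>L diag_op mu o\<^sub>L U) - diag_op lam) < e"
    by blast
qed

theorem corollary4p8:
  fixes G1 G2 :: "nat rel" and \<Lambda> :: "real set"
    and S T :: "'k::hilbert_scalar ell2 \<Rightarrow>\<^sub>L 'k ell2"
  assumes "simple_graph G1" and "simple_graph G2"
    and "compact \<Lambda>" and "infinite \<Lambda>"
    and "constructed_solution G1 \<Lambda> S" and "constructed_solution G2 \<Lambda> T"
  shows "S \<sim>\<^sub>a T \<and> (\<forall>lam. dense_enumeration lam \<Lambda> \<longrightarrow> T \<sim>\<^sub>a diag_op lam)"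
proof -
  obtain sig where S: "dense_enumeration sig \<Lambda>" "S \<sim>\<^sub>a diag_op sig"
    using constructed_solution_approx_diag[OF assms(3,5)] by blast
  obtain tau where T: "dense_enumeration tau \<Lambda>" "T \<sim>\<^sub>a diag_op tau"
    using constructed_solution_approx_diag[OF assms(3,6)] by blast
  have T_diag: "T \<sim>\<^sub>a diag_op lam" if "dense_enumeration lam \<Lambda>" for lam
    using approx_unitarily_equiv_trans[OF T(2)
        diag_op_approx_unitarily_equiv[OF assms(3) T(1) that]] .
  have "S \<sim>\<^sub>a T"
    using approx_unitarily_equiv_trans[OF S(2) approx_unitarily_equiv_sym[OF T_diag[OF S(1)]]] .
  with T_diag show ?thesis by blast
qed

end
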